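(* Let $A=(a_{ij})$, $i,j=1,\dots,n$, be a generic Hermitian quaternionic matrix, i.e. $a_{ji}=\bar a_{ij}$ for all $i,j$ and all square submatrices of $A$ are invertible. Then $\Delta(A)=M(A)$.
   Context: $\mathbb{H}$ is the algebra of real quaternions with conjugation $h\mapsto\bar h$. Quasideterminants: for a square matrix $A$ over a ring, $A^{ij}$ is the submatrix obtained by deleting the $i$-th row and $j$-th column. If $A^{ij}$ is invertible, $|A|_{ij}=a_{ij}-r_i^j(A^{ij})^{-1}c_j^i$, where $r_i^j$ is the $i$-th row of $A$ with $a_{ij}$ deleted and $c_j^i$ is the $j$-th column with $a_{ij}$ deleted; for a $1\times1$ matrix it is the entry. Submatrices keep the row and column indices of $A$. $A^{i_1\dots i_k,\,j_1\dots j_k}$ denotes the submatrix obtained from $A$ by deleting the rows $i_1,\dots,i_k$ and the columns $j_1,\dots,j_k$. The basic predeterminant is $$\Delta(A)=|A|_{11}\,|A^{11}|_{22}\,|A^{12,12}|_{33}\cdots a_{nn}.$$ Moore determinant: every permutation $\sigma\in S_n$ of $\{1,\dots,n\}$ is written uniquely as a product of disjoint cycles (including cycles of length one) $$\sigma=(k_{11}\dots k_{1j_1})(k_{21}\dots k_{2j_2})\cdots(k_{m1}\dots k_{mj_m})$$ with $k_{i1}<k_{ij}$ for all $i$ and all $j>1$, and $k_{11}>k_{21}>\dots>k_{m1}$. With $p(\sigma)\in\{\pm1\}$ the parity (sign) of $\sigma$, $$M(A)=\sum_{\sigma\in S_n}p(\sigma)\,\bigl(a_{k_{11}k_{12}}\cdots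 a_{k_{1j_1}k_{11}}\bigr)\bigl(a_{k_{21}k_{22}}\cdots a_{k_{2j_2}k_{21}}\bigr)\cdots\bigl(a_{k_{m1}k_{m2}}\cdots a_{k_{mj_m}k_{m1}}\bigr),$$ where a cycle $(k)$ of length one contributes the factor $a_{kk}$. *)

theory Defs
  imports Complex_Main "HOL-Combinatorics.Combinatorics"
begin

section \<open>Quaternions\<close>

datatype quat = Quat (qre: real) (qi: real) (qj: real) (qk: real)

lemma quat_eq_iff: "x = y \<longleftrightarrow> qre x = qre y \<and> qi x = qi y \<and> qj x = qj y \<and> qk x = qk y"
  by (auto intro: quat.expand)

instantiation quat :: real_div_algebra
begin

definition zero_quat where "0 = Quat 0 0 0 0"
definition one_quat where "1 = Quat 1 0 0 0"
definition uminus_quat where "- x = Quat (- qre x) (- qi x) (- qj x) (- qk x)"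
definition plus_quat where
  "x + y = Quat (qre x + qre y) (qi x + qi y) (qj x + qj y) (qk x + qk y)"
definition minus_quat where
  "x - y = Quat (qre x - qre y) (qi x - qi y) (qj x - qj y) (qk x - qk y)"
definition times_quat where
  "x * y = Quat (qre x * qre y - qi x * qi y - qj x * qj y - qk x * qk y)
                (qre x * qi y + qi x * qre y + qj x * qk y - qk x * qj y)
                (qre x * qj y - qi x * qk y + qj x * qre y + qk x * qi y)
                (qre x * qk y + qi x * qj y - qj x * qi y + qk x * qre y)"
definition scaleR_quat where
  "r *\<^sub>R x = Quat (r * qre x) (r * qi x) (r * qj x) (r * qk x)"
definition inverse_quat where
  "inverse x = (1 / ((qre x)\<^sup>2 + (qi x)\<^sup>2 + (qj x)\<^sup>2 + (qk x)\<^sup>2)) *\<^sub>R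
     Quat (qre x) (- qi x) (- qj x) (- qk x)"
definition divide_quat where "x div y = x * inverse y" for x y :: quat

lemmas quat_defs = zero_quat_def one_quat_def uminus_quat_def plus_quat_def minus_quat_def
  times_quat_def scaleR_quat_def

instance
proof
  fix x y z :: quat and a b :: real
  show "x \<noteq> 0 \<Longrightarrow> inverse x * x = 1" "x \<noteq> 0 \<Longrightarrow> x * inverse x = 1"
  proof -
    assume "x \<noteq> 0"
    then have "(qre x)\<^sup>2 + (qi x)\<^sup>2 + (qj x)\<^sup>2 + (qk x)\<^sup>2 \<noteq> 0"
      by (auto simp: quat_eq_iff quat_defs add_nonneg_eq_0_iff)
    then show "inverse x * x = 1" "x * inverse x = 1"
      unfolding inverse_quat_def quat_defs by (simp_all add: divide_simps power2_eq_square)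
  qed
qed (simp_all add: quat_eq_iff quat_defs inverse_quat_def divide_quat_def algebra_simps)

end

definition qcnj :: "quat \<Rightarrow> quat" where
  "qcnj x = Quat (qre x) (- qi x) (- qj x) (- qk x)"


section \<open>Submatrices, quasideterminants, basic predeterminant\<close>

text \<open>
  A matrix is an entry function \<open>A\<close> together with a finite set \<open>I\<close> of row indices and a finite
  set \<open>J\<close> of column indices; only the entries in \<open>I \<times> J\<close> matter. Passing to a submatrix shrinks
  \<open>I\<close> and \<open>J\<close> and leaves \<open>A\<close> alone, so submatrices keep their indices. An inverse of the
  \<open>I \<times> J\<close> matrix is a \<open>J \<times> I\<close> matrix.
\<close>

definition is_inverse_on ::
    "(nat \<Rightarrow> nat \<Rightarrow> 'a::ring_1) \<Rightarrow> nat set \<Rightarrow> nat set \<Rightarrow> (nat \<Rightarrow> nat \<Rightarrow> 'a) \<Rightarrow> bool" where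
  "is_inverse_on A I J B \<longleftrightarrow>
     (\<forall>p\<in>I. \<forall>p'\<in>I. (\<Sum>q\<in>J. A p q * B q p') = (if p = p' then 1 else 0)) \<and>
     (\<forall>q\<in>J. \<forall>q'\<in>J. (\<Sum>p\<in>I. B q p * A p q') = (if q = q' then 1 else 0))"

definition invertible_on :: "(nat \<Rightarrow> nat \<Rightarrow> 'a::ring_1) \<Rightarrow> nat set \<Rightarrow> nat set \<Rightarrow> bool" where
  "invertible_on A I J \<longleftrightarrow> (\<exists>B. is_inverse_on A I J B)"

text \<open>The entries of the inverse in \<open>J \<times> I\<close> are uniquely determined; the choice only concerns the
  irrelevant entries outside \<open>J \<times> I\<close>.\<close>

definition inverse_on ::
    "(nat \<Rightarrow> nat \<Rightarrow> 'a::ring_1) \<Rightarrow> nat set \<Rightarrow> nat set \<Rightarrow> nat \<Rightarrow> nat \<Rightarrow> 'a" where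
  "inverse_on A I J = (SOME B. is_inverse_on A I J B)"

lemma is_inverse_on_unique:
  assumes "finite I" "finite J" "is_inverse_on A I J B" "is_inverse_on A I J C" "q \<in> J" "p \<in> I"
  shows "B q p = C q p"
proof -
  have "B q p = (\<Sum>p'\<in>I. B q p' * (\<Sum>q'\<in>J. A p' q' * C q' p))"
  proof -
    have "(\<Sum>p'\<in>I. B q p' * (\<Sum>q'\<in>J. A p' q' * C q' p)) = (\<Sum>p'\<in>I. if p' = p then B q p' else 0)"
      using assms by (intro sum.cong) (auto simp: is_inverse_on_def)
    then show ?thesis using assms by simp
  qed
  also have "\<dots> = (\<Sum>q'\<in>J. (\<Sum>p'\<in>I. B q p' * A p' q') * C q' p)"
    unfolding sum_distrib_left sum_distrib_right mult.assoc by (rule sum.swap)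
  also have "\<dots> = (\<Sum>q'\<in>J. if q = q' then C q' p else 0)"
    using assms by (intro sum.cong) (auto simp: is_inverse_on_def)
  also have "\<dots> = C q p"
    using assms by simp
  finally show ?thesis .
qed

text \<open>The quasideterminant \<open>|A|\<^sub>i\<^sub>j\<close> of the square matrix with rows \<open>I \<ni> i\<close> and columns \<open>J \<ni> j\<close>,
  meaningful when the matrix with rows \<open>I - {i}\<close> and columns \<open>J - {j}\<close> is invertible. For a
  \<open>1 \<times> 1\<close> matrix the sum is empty and the value is the entry.\<close>

definition quasidet ::
    "(nat \<Rightarrow> nat \<Rightarrow> 'a::ring_1) \<Rightarrow> nat set \<Rightarrow> nat set \<Rightarrow> nat \<Rightarrow> nat \<Rightarrow> 'a" where
  "quasidet A I J i j =
     A i j - (\<Sum>q\<in>J - {j}. \<Sum>p\<in>I - {i}. A i q * inverse_on A (I - {i}) (J - {j}) q p * A p j)"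

text \<open>The \<open>k\<close>-th factor is the \<open>(k,k)\<close> quasideterminant of the submatrix with rows and columns
  \<open>1,\<dots>,k-1\<close> deleted; the order of the factors matters.\<close>

definition predet :: "nat \<Rightarrow> (nat \<Rightarrow> nat \<Rightarrow> 'a::ring_1) \<Rightarrow> 'a" where
  "predet n A =
     (\<Prod>k\<leftarrow>[1..<n+1]. quasidet A ({1..n} - {1..<k}) ({1..n} - {1..<k}) k k)"


section \<open>Moore determinant\<close>

text \<open>\<open>moore_cycles n \<sigma> cs\<close>: \<open>cs\<close> is the list of cycles, fixed points included, of the permutation
  \<open>\<sigma>\<close> of \<open>{1..n}\<close>, each written with its least element first, in decreasing order of first
  elements. The cycle \<open>(k\<^sub>1 k\<^sub>2 \<dots>)\<close> maps \<open>k\<^sub>1\<close> to \<open>k\<^sub>2\<close>.\<close>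

definition moore_cycles :: "nat \<Rightarrow> (nat \<Rightarrow> nat) \<Rightarrow> nat list list \<Rightarrow> bool" where
  "moore_cycles n \<sigma> cs \<longleftrightarrow>
     [] \<notin> set cs \<and> distinct (concat cs) \<and> set (concat cs) = {1..n} \<and>
     (\<forall>c\<in>set cs. \<forall>x\<in>set (tl c). hd c < x) \<and>
     sorted_wrt (>) (map hd cs) \<and>
     \<sigma> = foldr (\<circ>) (map cycle_of_list cs) id"

lemma foldr_cycles_apply:
  assumes "distinct (concat cs)"
  shows "c \<in> set cs \<Longrightarrow> x \<in> set c \<Longrightarrow> foldr (\<circ>) (map cycle_of_list cs) id x = cycle_of_list c x"
    and "x \<notin> set (concat cs) \<Longrightarrow> foldr (\<circ>) (map cycle_of_list cs) id x = x"
proof -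
  have *: "(\<forall>c\<in>set cs. \<forall>x\<in>set c. foldr (\<circ>) (map cycle_of_list cs) id x = cycle_of_list c x) \<and>
     (\<forall>x. x \<notin> set (concat cs) \<longrightarrow> foldr (\<circ>) (map cycle_of_list cs) id x = x)"
    using assms
  proof (induction cs)
    case (Cons d cs)
    have d: "distinct d" "set d \<inter> set (concat cs) = {}" and
      IH: "\<And>c x. c \<in> set cs \<Longrightarrow> x \<in> set c \<Longrightarrow>
             foldr (\<circ>) (map cycle_of_list cs) id x = cycle_of_list c x"
          "\<And>x. x \<notin> set (concat cs) \<Longrightarrow> foldr (\<circ>) (map cycle_of_list cs) id x = x"
      using Cons.IH Cons.prems unfolding concat.simps distinct_append by blast+
    have "foldr (\<circ>) (map cycle_of_list (d # cs)) id x = cycle_of_list c x"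
      if "c \<in> set cs" "x \<in> set c" for c x
    proof -
      have "distinct c"
        using that Cons.prems by (auto simp: distinct_concat_iff)
      then have "cycle_of_list c x \<in> set c"
        using cycle_is_surj[of c] that by blast
      then have "cycle_of_list c x \<notin> set d"
        using d that by auto
      then show ?thesis
        using that IH by (simp add: id_outside_supp)
    qed
    moreover have "foldr (\<circ>) (map cycle_of_list (d # cs)) id x = cycle_of_list d x"
      if "x \<in> set d" for x
    proof -
      have "x \<notin> set (concat cs)" using that d by blast
      from IH(2)[OF this] show ?thesis by simp
    qed
    moreover have "foldr (\<circ>) (map cycle_of_list (d # cs)) id x = x"
      if "x \<notin> set (concat (d # cs))" for x
      using that IH(2)[of x] by (simp add: id_outside_supp)
    ultimately show ?case by (intro conjI ballI allI impI) (auto simp only: list.set insert_iff)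
  qed simp
  from * show "c \<in> set cs \<Longrightarrow> x \<in> set c \<Longrightarrow>
      foldr (\<circ>) (map cycle_of_list cs) id x = cycle_of_list c x"
    and "x \<notin> set (concat cs) \<Longrightarrow> foldr (\<circ>) (map cycle_of_list cs) id x = x"
    by blast+
qed

lemma cycle_of_list_funpow_hd:
  assumes "distinct c" "c \<noteq> []"
  shows "(cycle_of_list c ^^ t) (hd c) = c ! (t mod length c)"
proof -
  have "(cycle_of_list c ^^ t) (hd c) = hd (rotate t c)"
    using cyclic_rotation[OF assms(1), of t] assms(2) by (metis hd_map)
  then show ?thesis
    using assms(2) by (simp add: hd_rotate_conv_nth)
qed

lemma moore_cycles_explicit:
  assumes "moore_cycles n \<sigma> cs"
  shows "cs = map (support \<sigma>) (rev (sorted_list_of_set {k \<in> {1..n}. \<forall>t. k \<le> (\<sigma> ^^ t) k}))"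
proof -
  from assms have ne: "[] \<notin> set cs" and dc: "distinct (concat cs)"
    and sc: "set (concat cs) = {1..n}"
    and mn: "\<And>c x. c \<in> set cs \<Longrightarrow> x \<in> set (tl c) \<Longrightarrow> hd c < x"
    and so: "sorted_wrt (>) (map hd cs)" and \<sigma>: "\<sigma> = foldr (\<circ>) (map cycle_of_list cs) id"
    by (auto simp: moore_cycles_def)
  have pw: "(\<sigma> ^^ t) (hd c) = c ! (t mod length c)" and disc: "distinct c" and nec: "c \<noteq> []"
    if c: "c \<in> set cs" for c t
  proof -
    show "distinct c" "c \<noteq> []"
      using c ne dc by (auto simp: distinct_concat_iff)
    have "(\<sigma> ^^ t) (hd c) = (cycle_of_list c ^^ t) (hd c)"
    proof (induction t)
      case (Suc t)
      have "(cycle_of_list c ^^ t) (hd c) \<in> set c"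
        using cycle_of_list_funpow_hd[OF \<open>distinct c\<close> \<open>c \<noteq> []\<close>] \<open>c \<noteq> []\<close> by simp
      then show ?case
        using Suc foldr_cycles_apply(1)[OF dc c] by (simp add: \<sigma>)
    qed simp
    then show "(\<sigma> ^^ t) (hd c) = c ! (t mod length c)"
      using cycle_of_list_funpow_hd[OF \<open>distinct c\<close> \<open>c \<noteq> []\<close>] by simp
  qed
  have sup: "support \<sigma> (hd c) = c" if c: "c \<in> set cs" for c
  proof -
    have "least_power \<sigma> (hd c) = length c"
      unfolding least_power_def
    proof (rule Least_equality)
      show "(\<sigma> ^^ length c) (hd c) = hd c \<and> 0 < length c"
        using pw[OF c] nec[OF c] by (simp add: hd_conv_nth)
      fix m assume m: "(\<sigma> ^^ m) (hd c) = hd c \<and> 0 < m"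
      show "length c \<le> m"
      proof (rule ccontr)
        assume "\<not> length c \<le> m"
        then have "c ! m = c ! 0"
          using m pw[OF c, of m] nec[OF c] by (simp add: hd_conv_nth)
        then show False
          using disc[OF c] m \<open>\<not> length c \<le> m\<close> nec[OF c] nth_eq_iff_index_eq[of c m 0]
            \<open>c ! m = c ! 0\<close> by simp
      qed
    qed
    then show ?thesis
      using pw[OF c] by (auto intro!: nth_equalityI)
  qed
  have lehd: "hd c \<le> x" if "c \<in> set cs" "x \<in> set c" for c x
    using mn[OF that(1), of x] that ne by (cases c) auto
  have "set (map hd cs) = {k \<in> {1..n}. \<forall>t. k \<le> (\<sigma> ^^ t) k}"
  proof (intro equalityI subsetI)
    fix k assume "k \<in> set (map hd cs)"
    then obtain c where c: "c \<in> set cs" "k = hd c" by auto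
    have "hd c \<in> set c" using nec[OF c(1)] by simp
    then have "k \<in> {1..n}" using c sc by auto
    moreover have "k \<le> (\<sigma> ^^ t) k" for t
      using lehd[OF c(1), of "c ! (t mod length c)"] c pw[OF c(1), of t] nec[OF c(1)] by simp
    ultimately show "k \<in> {k \<in> {1..n}. \<forall>t. k \<le> (\<sigma> ^^ t) k}" by simp
  next
    fix k assume k: "k \<in> {k \<in> {1..n}. \<forall>t. k \<le> (\<sigma> ^^ t) k}"
    then have "k \<in> set (concat cs)"
      using sc by auto
    then obtain c where c: "c \<in> set cs" "k \<in> set c"
      by auto
    then obtain i where i: "i < length c" "k = c ! i"
      by (auto simp: in_set_conv_nth)
    have "(\<sigma> ^^ (length c - i)) k = (\<sigma> ^^ (length c - i)) ((\<sigma> ^^ i) (hd c))"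
      using pw[OF c(1), of i] i by simp
    also have "\<dots> = (\<sigma> ^^ (length c - i + i)) (hd c)"
      by (simp add: funpow_add)
    also have "\<dots> = hd c"
      using pw[OF c(1), of "length c"] i nec[OF c(1)] by (simp add: hd_conv_nth)
    finally have "k \<le> hd c" using k by (metis (mono_tags, lifting) mem_Collect_eq)
    with lehd[OF c] have "k = hd c" by simp
    then show "k \<in> set (map hd cs)" using c by simp
  qed
  moreover have "sorted_wrt (<) (rev (map hd cs))"
    using so by (simp add: sorted_wrt_rev del: map_map flip: rev_map)
  ultimately have "sorted_list_of_set {k \<in> {1..n}. \<forall>t. k \<le> (\<sigma> ^^ t) k} = rev (map hd cs)"
    by (metis sorted_list_of_set.idem_if_sorted_distinct set_rev strict_sorted_iff)
  then have "map (support \<sigma>) (rev (sorted_list_of_set {k \<in> {1..n}. \<forall>t. k \<le> (\<sigma> ^^ t) k}))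
    = map (\<lambda>c. support \<sigma> (hd c)) cs" by (simp add: comp_def)
  also have "\<dots> = map (\<lambda>c. c) cs" using sup by (intro map_cong) auto
  finally show ?thesis by simp
qed

lemma moore_cycles_ex:
  assumes "\<sigma> permutes {1..n}"
  shows "moore_cycles n \<sigma> (map (support \<sigma>) (rev (sorted_list_of_set {k \<in> {1..n}. \<forall>t. k \<le> (\<sigma> ^^ t) k})))"
proof -
  define L where "L = {k \<in> {1..n}. \<forall>t. k \<le> (\<sigma> ^^ t) k}"
  define S where "S = (\<lambda>k. support \<sigma> k)"
  define cs where "cs = map S (rev (sorted_list_of_set L))"
  have perm: "permutation \<sigma>"
    using assms by (auto simp: permutation_permutes)
  have finL: "finite L" by (simp add: L_def)
  have lp: "least_power \<sigma> k > 0" for k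
    using least_power_of_permutation(2)[OF perm] .
  have nes: "S k \<noteq> []" and hds: "hd (S k) = k" for k
    using lp[of k] by (simp_all add: S_def hd_map)
  have ss: "set (S k) = range (\<lambda>i. (\<sigma> ^^ i) k)" for k
    unfolding S_def by (rule support_set[OF perm])
  have dS: "distinct (S k)" for k
    unfolding S_def by (rule cycle_of_permutation[OF perm])
  have kin: "k \<in> set (S k)" for k
    using hd_in_set[OF nes[of k]] by (simp only: hds)
  have eqS: "set (S a) = set (S b)" if "set (S a) \<inter> set (S b) \<noteq> {}" for a b
    using disjoint_support[OF perm] that unfolding S_def by (meson UNIV_I disjoint_def image_iff)
  have scs: "set cs = S ` L"
    using finL by (simp add: cs_def)
  have dis: "set (S a) \<inter> set (S b) = {}" if "a \<in> L" "b \<in> L" "a \<noteq> b" for a b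
  proof (rule ccontr)
    assume "\<not> ?thesis"
    then have "set (S a) = set (S b)" by (rule eqS)
    then have "a \<in> range (\<lambda>i. (\<sigma> ^^ i) b)" "b \<in> range (\<lambda>i. (\<sigma> ^^ i) a)"
      using kin ss by metis+
    then obtain s t where "a = (\<sigma> ^^ s) b" "b = (\<sigma> ^^ t) a" by blast
    moreover have "b \<le> (\<sigma> ^^ s) b" "a \<le> (\<sigma> ^^ t) a" using that by (simp_all add: L_def)
    ultimately have "b \<le> a" "a \<le> b" by simp_all
    then show False using that by simp
  qed
  have injs: "inj_on S L"
    by (rule inj_onI) (metis hds)
  have 1: "[] \<notin> set cs" using scs nes by (metis imageE)
  have dcs: "distinct cs"
    using injs finL by (simp add: distinct_map cs_def)
  have 2: "distinct (concat cs)"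
  proof (rule distinct_concat[OF dcs])
    show "distinct ys" if "ys \<in> set cs" for ys
      using that scs dS by auto
    show "set ys \<inter> set zs = {}" if "ys \<in> set cs" "zs \<in> set cs" "ys \<noteq> zs" for ys zs
      using that scs dis by auto
  qed
  have 3: "set (concat cs) = {1..n}"
  proof (intro equalityI subsetI)
    fix x assume "x \<in> set (concat cs)"
    then obtain k i where "k \<in> L" "x = (\<sigma> ^^ i) k"
      using scs ss by auto
    then show "x \<in> {1..n}"
      using permutes_in_image[OF permutes_funpow[OF assms]] by (simp add: L_def)
  next
    fix x assume x: "x \<in> {1..n}"
    define k where "k = (LEAST y. y \<in> set (S x))"
    have k: "k \<in> set (S x)"
      unfolding k_def by (rule LeastI[of _ x]) (rule kin)
    then have eq: "set (S k) = set (S x)"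
      using kin[of k] by (intro eqS) blast
    have "k \<le> (\<sigma> ^^ t) k" for t
    proof -
      have "(\<sigma> ^^ t) k \<in> set (S x)" using eq ss[of k] by blast
      then show ?thesis unfolding k_def by (rule Least_le)
    qed
    moreover obtain i where "k = (\<sigma> ^^ i) x" using k ss[of x] by blast
    then have "k \<in> {1..n}"
      using x permutes_in_image[OF permutes_funpow[OF assms]] by simp
    ultimately have "k \<in> L" by (simp add: L_def)
    moreover have "x \<in> set (S k)"
      using eq kin by blast
    ultimately show "x \<in> set (concat cs)" using scs by auto
  qed
  have 4: "hd c < x" if "c \<in> set cs" "x \<in> set (tl c)" for c x
  proof -
    from that(1) obtain k where k: "k \<in> L" "c = S k"
      unfolding scs by blast
    have c: "c = k # tl c" using hds[of k] nes[of k] k(2) by (metis list.collapse)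
    then have "x \<noteq> k" using dS[of k] k(2) that(2) by (metis distinct.simps(2))
    moreover have "x \<in> set (S k)" using c k(2) that(2) by (metis list.set_intros(2))
    then obtain t where "x = (\<sigma> ^^ t) k" using ss[of k] by blast
    then have "k \<le> x" using k(1) by (simp add: L_def)
    ultimately show ?thesis using k(2) hds[of k] by simp
  qed
  have "map hd cs = rev (sorted_list_of_set L)"
    by (simp add: cs_def comp_def hds)
  then have 5: "sorted_wrt (>) (map hd cs)"
    by (simp add: sorted_wrt_rev)
  have 6: "\<sigma> = foldr (\<circ>) (map cycle_of_list cs) id"
  proof
    fix x
    show "\<sigma> x = foldr (\<circ>) (map cycle_of_list cs) id x"
    proof (cases "x \<in> {1..n}")
      case True
      then obtain c where c: "c \<in> set cs" "x \<in> set c"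
        using 3 by (metis UN_E set_concat)
      from c(1) obtain k where k: "c = S k"
        unfolding scs by blast
      have "\<sigma> x = cycle_of_list c x"
        using cycle_restrict[OF perm] c(2) unfolding k S_def by blast
      then show ?thesis
        using foldr_cycles_apply(1)[OF 2 c] by simp
    next
      case False
      then show ?thesis
        using foldr_cycles_apply(2)[OF 2, unfolded 3, OF False] permutes_not_in[OF assms False]
        by simp
    qed
  qed
  from 1 2 3 4 5 6 have "moore_cycles n \<sigma> cs"
    unfolding moore_cycles_def by blast
  then show ?thesis
    by (simp only: cs_def S_def L_def)
qed

lemma moore_cycles_ex1:
  assumes "\<sigma> permutes {1..n}"
  shows "\<exists>!cs. moore_cycles n \<sigma> cs"
  by (rule ex1I, rule moore_cycles_ex[OF assms], erule moore_cycles_explicit)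

definition cycle_factor :: "(nat \<Rightarrow> nat \<Rightarrow> 'a::ring_1) \<Rightarrow> nat list \<Rightarrow> 'a" where
  "cycle_factor A c = (\<Prod>i\<leftarrow>[0..<length c]. A (c ! i) (c ! (Suc i mod length c)))"

definition moore_det :: "nat \<Rightarrow> (nat \<Rightarrow> nat \<Rightarrow> 'a::ring_1) \<Rightarrow> 'a" where
  "moore_det n A = (\<Sum>\<sigma> | \<sigma> permutes {1..n}.
     of_int (sign \<sigma>) * (\<Prod>c\<leftarrow>(THE cs. moore_cycles n \<sigma> cs). cycle_factor A c))"

end

theory Submission
  imports Defs
begin

text \<open>
  Reversing a cycle conjugates its product, so in the Moore determinant every cycle product may be
  replaced by its real part. As \<open>Re (x y) = Re (y x)\<close>, the Moore determinants \<open>M I\<close> of the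
  principal submatrices are real and can be expanded along the cycles through any chosen index,
  not only the least one. Hence summing, over the simple paths from \<open>q\<close> to \<open>p\<close> in \<open>J\<close>, the
  signed product along the path times the Moore determinant of the complement gives the
  \<open>(q, p)\<close> entry of a right adjugate: its product with \<open>A\<close> is \<open>M J\<close> times the identity,
  because the cycles cut off by a repeated index cancel against the remaining paths.
  Inserting this into the quasideterminant with \<open>I = J \<union> {k}\<close> closes the paths up to
  cycles through \<open>k\<close>, so that \<open>|A\<^sub>I|\<^sub>k\<^sub>k M J = M I\<close>, and the product telescopes.
\<close>

section \<open>Conjugation\<close>

lemma qcnj_simps [simp]:
  "qcnj (x * y) = qcnj y * qcnj x" "qcnj (x + y) = qcnj x + qcnj y" "qcnj (- x) = - qcnj x"
  "qcnj (r *\<^sub>R x) = r *\<^sub>R qcnj x" "qcnj 0 = 0" "qcnj 1 = 1"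
  by (simp_all add: qcnj_def quat_defs algebra_simps)

lemma qcnj_sum: "qcnj (\<Sum>x\<in>S. f x) = (\<Sum>x\<in>S. qcnj (f x))"
  by (induction S rule: infinite_finite_induct) simp_all

lemma qre_simps [simp]:
  "qre (x + y) = qre x + qre y" "qre (- x) = - qre x" "qre (r *\<^sub>R x) = r * qre x"
  "qre 0 = 0" "qre 1 = 1"
  by (simp_all add: quat_defs)

lemma qre_sum: "qre (\<Sum>x\<in>S. f x) = (\<Sum>x\<in>S. qre (f x))"
  by (induction S rule: infinite_finite_induct) simp_all

lemma qre_mult_commute: "qre (x * y) = qre (y * x)"
  by (simp add: quat_defs algebra_simps)

lemma qcnj_fixed: "qcnj x = x \<Longrightarrow> x = of_real (qre x)"
  by (simp add: quat_eq_iff qcnj_def of_real_def quat_defs)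

lemma mult_of_real_commute: "x * of_real r = of_real r * (x :: 'a::real_algebra_1)"
  by (simp add: of_real_def)

section \<open>Signed walks\<close>

text \<open>A minus sign per step makes \<open>- walk A (k # s @ [k])\<close> the product of the cycle \<open>k # s\<close>
  times its sign.\<close>

fun walk :: "(nat \<Rightarrow> nat \<Rightarrow> 'a::ring_1) \<Rightarrow> nat list \<Rightarrow> 'a" where
  "walk A (x # y # s) = - (A x y * walk A (y # s))"
| "walk A _ = 1"

lemma walk_append: "walk A (s @ x # t) = walk A (s @ [x]) * walk A (x # t)"
  by (induction A s rule: walk.induct) (auto simp: mult.assoc neq_Nil_conv split: list.splits)

lemma walk_Cons: "s \<noteq> [] \<Longrightarrow> walk A (x # s) = - (A x (hd s) * walk A s)"
  by (cases s) auto

lemma walk_conv_prod_list: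
  "walk A s = (-1) ^ (length s - 1) * (\<Prod>i\<leftarrow>[0..<length s - 1]. A (s ! i) (s ! Suc i))"
proof (induction A s rule: walk.induct)
  case (1 A x y s)
  have "[0..<Suc (length s)] = 0 # map Suc [0..<length s]"
    by (metis map_Suc_upt upt_conv_Cons zero_less_Suc)
  moreover have "A x y * (-1) ^ m = (-1) ^ m * A x y" for m
    by (induction m) simp_all
  ultimately show ?case
    using 1 by (simp add: comp_def mult.assoc [symmetric] del: upt_Suc)
qed simp_all

lemma walk_closed:
  assumes "c \<noteq> []"
  shows "walk A (c @ [hd c]) = (-1) ^ length c * cycle_factor A c"
proof -
  have "(\<Prod>i\<leftarrow>[0..<length c]. A ((c @ [hd c]) ! i) ((c @ [hd c]) ! Suc i)) = cycle_factor A c"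
    unfolding cycle_factor_def
  proof (intro arg_cong[where f = prod_list] map_cong refl)
    fix i assume "i \<in> set [0..<length c]"
    then have i: "i < length c" by simp
    show "A ((c @ [hd c]) ! i) ((c @ [hd c]) ! Suc i) = A (c ! i) (c ! (Suc i mod length c))"
    proof (cases "Suc i = length c")
      case True
      then show ?thesis using assms i by (simp add: nth_append hd_conv_nth)
    next
      case False
      then show ?thesis using assms i by (simp add: nth_append)
    qed
  qed
  then show ?thesis by (simp add: walk_conv_prod_list)
qed

section \<open>Simple paths and ways of cutting them\<close>

definition paths :: "'a set \<Rightarrow> 'a list set" where
  "paths S = {s. set s \<subseteq> S \<and> distinct s}"

text \<open>Ordered pairs of disjoint paths in \<open>S\<close>. The asymmetric form lets a sum over
  pairs be read as an iterated sum, while \<open>path_pairs_swap\<close> recovers the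
  symmetry.\<close>

definition path_pairs :: "'a set \<Rightarrow> ('a list \<times> 'a list) set" where
  "path_pairs S = (SIGMA s : paths S. paths (S - set s))"

lemma finite_paths [simp]: "finite S \<Longrightarrow> finite (paths S)"
  using finite_subset_distinct[of S] by (simp add: paths_def)

lemma rev_in_paths [simp]: "rev s \<in> paths S \<longleftrightarrow> s \<in> paths S"
  by (simp add: paths_def)

lemma path_pairs_swap: "(s, t) \<in> path_pairs S \<Longrightarrow> (t, s) \<in> path_pairs S"
  by (auto simp: path_pairs_def paths_def)

lemma sum_path_pairs:
  assumes "finite S"
  shows "(\<Sum>(s, t)\<in>path_pairs S. f s t) = (\<Sum>s\<in>paths S. \<Sum>t\<in>paths (S - set s). f s t)"
  unfolding path_pairs_def using assms by (intro sum.Sigma [symmetric]) auto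

lemma sum_path_pairs_swap:
  "(\<Sum>(s, t)\<in>path_pairs S. f s t) = (\<Sum>(s, t)\<in>path_pairs S. f t s)"
  by (rule sum.reindex_bij_witness[where i = prod.swap and j = prod.swap])
     (auto intro: path_pairs_swap)

text \<open>A path visits \<open>k\<close> at most once, so a path through \<open>k\<close> falls
  uniquely into the part before and the part after it. This is the basis of every cut of a cycle or
  path below.\<close>

lemma sum_paths_split:
  assumes "finite S" "k \<in> S"
  shows "(\<Sum>s\<in>paths S. f s) =
    (\<Sum>s\<in>paths (S - {k}). f s) + (\<Sum>(u, v)\<in>path_pairs (S - {k}). f (u @ k # v))"
proof -
  have "(\<Sum>s\<in>paths S. f s) = (\<Sum>s | s \<in> paths S \<and> k \<notin> set s. f s) + (\<Sum>s | s \<in> paths S \<and> k \<in> set s. f s)"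
    using assms by (subst sum.union_disjoint [symmetric]) (auto intro!: sum.cong)
  moreover have "{s. s \<in> paths S \<and> k \<notin> set s} = paths (S - {k})"
    by (auto simp: paths_def)
  moreover have "(\<Sum>s | s \<in> paths S \<and> k \<in> set s. f s) =
      (\<Sum>(u, v)\<in>path_pairs (S - {k}). f (u @ k # v))"
  proof -
    have "bij_betw (\<lambda>(u, v). u @ k # v) (path_pairs (S - {k})) {s. s \<in> paths S \<and> k \<in> set s}"
      unfolding bij_betw_def
    proof
      have "k \<notin> set u \<and> k \<notin> set v" if "(u, v) \<in> path_pairs (S - {k})" for u v
        using that by (auto simp: path_pairs_def paths_def)
      then show "inj_on (\<lambda>(u, v). u @ k # v) (path_pairs (S - {k}))"
        unfolding inj_on_def by (fastforce simp: append_Cons_eq_iff)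
      show "(\<lambda>(u, v). u @ k # v) ` path_pairs (S - {k}) = {s. s \<in> paths S \<and> k \<in> set s}"
      proof (intro equalityI subsetI)
        fix s assume "s \<in> {s. s \<in> paths S \<and> k \<in> set s}"
        moreover from this obtain u v where "s = u @ k # v" by (auto dest: split_list)
        ultimately show "s \<in> (\<lambda>(u, v). u @ k # v) ` path_pairs (S - {k})"
          by (intro image_eqI[of _ _ "(u, v)"]) (auto simp: path_pairs_def paths_def)
      qed (use assms in \<open>auto simp: path_pairs_def paths_def\<close>)
    qed
    from sum.reindex_bij_betw[OF this, of f] show ?thesis by (simp add: case_prod_beta)
  qed
  ultimately show ?thesis by simp
qed

text \<open>Isolates the last vertex \<open>p\<close> of a nonempty path; in the quasideterminant it
  will be the row index of the column entry \<open>A p k\<close>.\<close>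

lemma sum_paths_last:
  assumes "finite S"
  shows "(\<Sum>s\<in>paths S. f s) = f [] + (\<Sum>p\<in>S. \<Sum>r\<in>paths (S - {p}). f (r @ [p]))"
proof -
  have "(\<Sum>s\<in>paths S. f s) = f [] + (\<Sum>s\<in>paths S - {[]}. f s)"
    using assms by (intro sum.remove finite_paths) (simp_all add: paths_def)
  also have "(\<Sum>s\<in>paths S - {[]}. f s) = (\<Sum>(p, r)\<in>(SIGMA p : S. paths (S - {p})). f (r @ [p]))"
    by (rule sum.reindex_bij_witness[where i = "\<lambda>(p, r). r @ [p]" and j = "\<lambda>s. (last s, butlast s)"])
       (auto simp: paths_def distinct_butlast dest: in_set_butlastD,
        metis append_butlast_last_id distinct_append not_distinct_conv_prefix disjoint_iff list.set_intros(1))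
  also have "\<dots> = (\<Sum>p\<in>S. \<Sum>r\<in>paths (S - {p}). f (r @ [p]))"
    using assms by (intro sum.Sigma [symmetric]) auto
  finally show ?thesis .
qed

section \<open>Moore sums over index sets\<close>

text \<open>The conditions of \<open>moore_cycles\<close> without the permutation and over any index
  set, so that removing a cycle leaves an object of the same kind.\<close>

definition cycle_lists :: "nat set \<Rightarrow> nat list list set" where
  "cycle_lists I = {cs. [] \<notin> set cs \<and> distinct (concat cs) \<and> set (concat cs) = I \<and>
     (\<forall>c\<in>set cs. \<forall>x\<in>set (tl c). hd c < x) \<and> sorted_wrt (>) (map hd cs)}"

text \<open>The sign of the permutation is distributed over its cycles: by
  \<open>walk_closed\<close>, each factor is a cycle product times the sign of that cycle.\<close>

definition moore_sum :: "(nat \<Rightarrow> nat \<Rightarrow> 'a::ring_1) \<Rightarrow> nat set \<Rightarrow> 'a" where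
  "moore_sum A I = (\<Sum>cs\<in>cycle_lists I. \<Prod>c\<leftarrow>cs. - walk A (c @ [hd c]))"

lemma finite_cycle_lists: 
  assumes "finite I"
  shows "finite (cycle_lists I)"
proof (rule finite_subset)
  show "cycle_lists I \<subseteq> {cs. set cs \<subseteq> paths I \<and> distinct cs}"
    by (auto simp: cycle_lists_def paths_def distinct_concat_iff)
  show "finite {cs. set cs \<subseteq> paths I \<and> distinct cs}"
    using assms by (intro finite_subset_distinct finite_paths)
qed

lemma cycle_lists_empty: "cycle_lists {} = {[]}"
  by (auto simp: cycle_lists_def) (metis list.set_intros(1) neq_Nil_conv)

lemma moore_sum_empty [simp]: "moore_sum A {} = 1"
  by (simp add: moore_sum_def cycle_lists_empty)

text \<open>Each cycle starts with its least element and these starts decrease, so the cycle through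
  \<open>Min I\<close> can only be the last one.\<close>

lemma snoc_in_cycle_lists:
  assumes "finite I" "I \<noteq> {}"
  shows "cs @ [Min I # s] \<in> cycle_lists I \<longleftrightarrow>
    s \<in> paths (I - {Min I}) \<and> cs \<in> cycle_lists (I - {Min I} - set s)"
    (is "?L \<longleftrightarrow> ?R")
proof
  have ge: "Min I \<le> x" if "x \<in> I" for x using that assms by simp
  show ?R if ?L
    using that by (auto simp: cycle_lists_def paths_def sorted_wrt_append)
  assume R: ?R
  have "hd c > Min I" if "c \<in> set cs" for c
  proof -
    have "hd c \<in> set (concat cs)"
      using that R by (auto simp: cycle_lists_def intro!: bexI[of _ c] hd_in_set)
    then have "hd c \<in> I - {Min I}" using R by (auto simp: cycle_lists_def)
    then show ?thesis using ge[of "hd c"] by simp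
  qed
  moreover have "Min I < x" if "x \<in> set s" for x
    using that R ge[of x] by (auto simp: paths_def less_le)
  moreover have "Min I \<in> I" using assms by simp
  ultimately show ?L
    using R by (auto simp: cycle_lists_def paths_def sorted_wrt_append simp del: Min_in)
qed

lemma cycle_lists_last:
  assumes "finite I" "I \<noteq> {}" "cs \<in> cycle_lists I"
  obtains cs' s where "cs = cs' @ [Min I # s]"
proof -
  have cs: "[] \<notin> set cs" "set (concat cs) = I" "sorted_wrt (>) (map hd cs)"
    "\<And>c x. c \<in> set cs \<Longrightarrow> x \<in> set (tl c) \<Longrightarrow> hd c < x"
    using assms(3) by (auto simp: cycle_lists_def)
  have "cs \<noteq> []" using cs assms by auto
  then obtain cs' c where c: "cs = cs' @ [c]" by (metis append_butlast_last_id)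
  then have "c \<noteq> []" using cs by auto
  have le: "hd d \<le> x" if "d \<in> set cs" "x \<in> set d" for d x
    using cs(4)[OF that(1), of x] that by (cases d) auto
  have "hd c = Min I"
  proof (rule Min_eqI [symmetric])
    show "hd c \<in> I" using cs(2) c \<open>c \<noteq> []\<close> by auto
    fix y assume "y \<in> I"
    then obtain d where d: "d \<in> set cs" "y \<in> set d" using cs(2) by auto
    have "hd c \<le> hd d" using cs(3) c d by (auto simp: sorted_wrt_append less_imp_le)
    then show "hd c \<le> y" using le[OF d] by simp
  qed (use assms in simp)
  then have "c = Min I # tl c" using \<open>c \<noteq> []\<close> by (metis list.collapse)
  then show ?thesis using c that by metis
qed

text \<open>Splits off the last cycle, which is the one through \<open>Min I\<close>; since it is
  the rightmost factor, the rest of the product stays together on its left.\<close>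

lemma moore_sum_rec:
  assumes "finite I" "I \<noteq> {}"
  defines "k \<equiv> Min I"
  shows "moore_sum A I =
    - (\<Sum>s\<in>paths (I - {k}). moore_sum A (I - {k} - set s) * walk A (k # s @ [k]))"
proof -
  let ?w = "\<lambda>cs. \<Prod>c\<leftarrow>cs. - walk A (c @ [hd c])"
  have "moore_sum A I = (\<Sum>(s, cs)\<in>(SIGMA s : paths (I - {k}). cycle_lists (I - {k} - set s)).
      ?w (cs @ [k # s]))"
    unfolding moore_sum_def
  proof (rule sum.reindex_bij_witness[where i = "\<lambda>(s, cs). cs @ [k # s]"
        and j = "\<lambda>cs. (tl (last cs), butlast cs)"])
    fix cs assume cs: "cs \<in> cycle_lists I"
    then obtain cs' s where eq: "cs = cs' @ [k # s]"
      using cycle_lists_last[OF assms(1,2)] unfolding k_def by metis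
    show "(case (tl (last cs), butlast cs) of (s, cs) \<Rightarrow> cs @ [k # s]) = cs"
      using eq by simp
    show "(case (tl (last cs), butlast cs) of (s, cs) \<Rightarrow> ?w (cs @ [k # s])) = ?w cs"
      using eq by simp
    show "(tl (last cs), butlast cs) \<in> (SIGMA s : paths (I - {k}). cycle_lists (I - {k} - set s))"
      using cs snoc_in_cycle_lists[OF assms(1,2), of cs' s] unfolding eq k_def by simp
  next
    fix b assume "b \<in> (SIGMA s : paths (I - {k}). cycle_lists (I - {k} - set s))"
    then show "(case b of (s, cs) \<Rightarrow> cs @ [k # s]) \<in> cycle_lists I"
      using snoc_in_cycle_lists[OF assms(1,2)] unfolding k_def by auto
  qed auto
  also have "\<dots> = (\<Sum>s\<in>paths (I - {k}). \<Sum>cs\<in>cycle_lists (I - {k} - set s). ?w (cs @ [k # s]))"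
    using assms by (intro sum.Sigma [symmetric]) (auto intro: finite_cycle_lists)
  also have "\<dots> = - (\<Sum>s\<in>paths (I - {k}). moore_sum A (I - {k} - set s) * walk A (k # s @ [k]))"
    by (simp add: moore_sum_def sum_distrib_right sum_negf)
  finally show ?thesis .
qed

section \<open>From permutations to cycle lists\<close>

lemma sign_cycle_of_list: "distinct c \<Longrightarrow> sign (cycle_of_list c) = (-1) ^ (length c - 1)"
proof (induction c rule: cycle_of_list.induct)
  case (1 i j c)
  have "permutation (cycle_of_list (j # c))"
    using cycle_permutes[of "j # c"] permutation_permutes by blast
  then show ?case
    using 1 unfolding cycle_of_list.simps
    by (subst sign_compose) (simp_all add: permutation_swap_id sign_swap_id)
qed simp_all

lemma foldr_cycles_Cons:
  "foldr (\<circ>) (map cycle_of_list (c # cs)) id =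
    cycle_of_list c \<circ> foldr (\<circ>) (map cycle_of_list cs) id"
  by simp

lemma foldr_cycles_permutation:
  "permutation (foldr (\<circ>) (map cycle_of_list cs) id)"
proof (induction cs)
  case (Cons c cs)
  have "permutation (cycle_of_list c)"
    using cycle_permutes[of c] permutation_permutes by blast
  then show ?case using Cons unfolding foldr_cycles_Cons by (intro permutation_compose)
qed simp

lemma sign_foldr_cycles:
  assumes "\<forall>c\<in>set cs. distinct c"
  shows "sign (foldr (\<circ>) (map cycle_of_list cs) id) = (\<Prod>c\<leftarrow>cs. (-1) ^ (length c - 1))"
  using assms
proof (induction cs)
  case (Cons c cs)
  have "permutation (cycle_of_list c)"
    using cycle_permutes[of c] permutation_permutes by blast
  moreover have "sign (foldr (\<circ>) (map cycle_of_list cs) id) = (\<Prod>c\<leftarrow>cs. (-1) ^ (length c - 1))"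
    using Cons by (metis list.set_intros(2))
  moreover have "sign (cycle_of_list c) = (-1) ^ (length c - 1)"
    using Cons.prems by (intro sign_cycle_of_list) simp
  ultimately show ?case
    unfolding foldr_cycles_Cons
    by (simp only: list.map prod_list.Cons sign_compose foldr_cycles_permutation)
qed simp

lemma foldr_cycles_permutes:
  assumes "\<forall>c\<in>set cs. set c \<subseteq> S"
  shows "foldr (\<circ>) (map cycle_of_list cs) id permutes S"
  using assms
proof (induction cs)
  case (Cons c cs)
  then have "cycle_of_list c permutes S"
    using cycle_permutes[of c] permutes_subset by (metis list.set_intros(1))
  moreover have "foldr (\<circ>) (map cycle_of_list cs) id permutes S"
    using Cons by (metis list.set_intros(2))
  ultimately show ?case unfolding foldr_cycles_Cons by (rule permutes_compose[rotated])
qed (simp add: permutes_id)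

text \<open>Integers are central, so the signs of the individual cycles can be collected in front
  although the entries do not commute.\<close>

lemma prod_list_walks:
  assumes "[] \<notin> set cs"
  shows "(\<Prod>c\<leftarrow>cs. - walk A (c @ [hd c])) =
    of_int (\<Prod>c\<leftarrow>cs. (-1) ^ (length c - 1)) * (\<Prod>c\<leftarrow>cs. cycle_factor A c)"
  using assms
proof (induction cs)
  case (Cons c cs)
  have "- walk A (c @ [hd c]) = of_int ((-1) ^ (length c - 1)) * cycle_factor A c"
    using Cons.prems walk_closed[of c A] by (cases c) auto
  moreover have "of_int a * f * (of_int b * g) = of_int (a * b) * (f * g)" for a b and f g :: 'a
    by (metis mult.assoc mult_of_int_commute of_int_mult)
  ultimately show ?case using Cons by (simp del: of_int_power of_int_mult)
qed simp

text \<open>By \<open>moore_cycles_ex1\<close>, composing the cycles of a list is a bijection from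
  cycle lists onto permutations, along which the sum is reindexed.\<close>

lemma moore_det_eq_moore_sum: "moore_det n A = moore_sum A {1..n}"
proof -
  define F where "F = (\<lambda>cs. foldr (\<circ>) (map cycle_of_list cs) (id :: nat \<Rightarrow> nat))"
  let ?S = "{\<sigma>. \<sigma> permutes {1..n}}"
  have cycles_iff: "moore_cycles n \<sigma> cs \<longleftrightarrow> cs \<in> cycle_lists {1..n} \<and> \<sigma> = F cs" for \<sigma> cs
    by (simp only: moore_cycles_def cycle_lists_def F_def mem_Collect_eq conj_assoc)
  have F: "F cs \<in> ?S" if "cs \<in> cycle_lists {1..n}" for cs
    unfolding F_def using that foldr_cycles_permutes[of cs "{1..n}"]
    by (simp only: mem_Collect_eq cycle_lists_def) (metis UN_upper set_concat)
  have the_F: "(THE cs'. moore_cycles n (F cs) cs') = cs" if "cs \<in> cycle_lists {1..n}" for cs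
    using moore_cycles_ex1[of "F cs" n] F[OF that] that
    by (intro the1_equality) (simp_all only: cycles_iff mem_Collect_eq simp_thms)
  have "bij_betw F (cycle_lists {1..n}) ?S"
  proof (rule bij_betw_imageI)
    show "inj_on F (cycle_lists {1..n})" by (rule inj_onI) (metis the_F)
    show "F ` cycle_lists {1..n} = ?S"
    proof
      show "F ` cycle_lists {1..n} \<subseteq> ?S" using F by blast
      show "?S \<subseteq> F ` cycle_lists {1..n}"
        using moore_cycles_ex1[of _ n] unfolding cycles_iff by blast
    qed
  qed
  then have "moore_det n A = (\<Sum>cs\<in>cycle_lists {1..n}. of_int (sign (F cs)) *
      (\<Prod>c\<leftarrow>(THE cs'. moore_cycles n (F cs) cs'). cycle_factor A c))"
    unfolding moore_det_def by (rule sum.reindex_bij_betw [symmetric])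
  also have "\<dots> = moore_sum A {1..n}"
    unfolding moore_sum_def
  proof (rule sum.cong)
    fix cs assume cs: "cs \<in> cycle_lists {1..n}"
    then have "\<forall>c\<in>set cs. distinct c" "[] \<notin> set cs"
      by (simp_all add: cycle_lists_def distinct_concat_iff)
    then show "of_int (sign (F cs)) * (\<Prod>c\<leftarrow>(THE cs'. moore_cycles n (F cs) cs'). cycle_factor A c) =
        (\<Prod>c\<leftarrow>cs. - walk A (c @ [hd c]))"
      unfolding the_F[OF cs] unfolding F_def by (simp add: sign_foldr_cycles prod_list_walks del: of_int_power)
  qed simp
  finally show ?thesis .
qed

section \<open>Hermitian matrices\<close>

locale hermitian_matrix =
  fixes A :: "nat \<Rightarrow> nat \<Rightarrow> quat" and U :: "nat set"
  assumes finite_U: "finite U"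
    and hermitian: "i \<in> U \<Longrightarrow> j \<in> U \<Longrightarrow> A j i = qcnj (A i j)"
begin

text \<open>Conjugation reverses the order of the factors and turns each \<open>A x y\<close> into
  \<open>A y x\<close>.\<close>

lemma walk_rev: "set s \<subseteq> U \<Longrightarrow> walk A (rev s) = qcnj (walk A s)"
proof (induction s rule: induct_list012)
  case (3 x y s)
  have "walk A (rev (x # y # s)) = walk A (rev s @ [y]) * walk A [y, x]"
    using walk_append[of A "rev s" y "[x]"] by simp
  moreover have "A y x = qcnj (A x y)" using 3 by (intro hermitian) simp_all
  ultimately show ?case using 3 by simp
qed simp_all

text \<open>Reversing \<open>s\<close> keeps \<open>set s\<close>, hence the real weight, and
  conjugates the closed walk. The sum is therefore its own conjugate.\<close>

lemma sum_closed_walks_real: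
  assumes "S \<subseteq> U" "k \<in> U"
  shows "(\<Sum>s\<in>paths S. f (set s) *\<^sub>R walk A (k # s @ [k])) =
    of_real (\<Sum>s\<in>paths S. f (set s) * qre (walk A (k # s @ [k])))" (is "?X = _")
proof -
  have "qcnj ?X = (\<Sum>s\<in>paths S. f (set s) *\<^sub>R walk A (k # rev s @ [k]))"
    unfolding qcnj_sum
  proof (rule sum.cong)
    fix s assume "s \<in> paths S"
    then show "qcnj (f (set s) *\<^sub>R walk A (k # s @ [k])) = f (set s) *\<^sub>R walk A (k # rev s @ [k])"
      using walk_rev[of "k # s @ [k]"] assms by (auto simp: paths_def)
  qed simp
  also have "\<dots> = ?X"
    by (rule sum.reindex_bij_witness[where i = rev and j = rev]) auto
  finally show ?thesis
    by (subst qcnj_fixed) (simp_all add: qre_sum)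
qed

definition moore_real :: "nat set \<Rightarrow> real" where
  "moore_real I = qre (moore_sum A I)"

text \<open>In \<open>moore_sum_rec\<close> the complements of the cycle are smaller, so inductively
  their sums are real weights and \<open>sum_closed_walks_real\<close> applies.\<close>

lemma moore_sum_eq_moore_real: "I \<subseteq> U \<Longrightarrow> moore_sum A I = of_real (moore_real I)"
proof (induction "card I" arbitrary: I rule: less_induct)
  case less
  then have fin: "finite I" using finite_U finite_subset by blast
  show ?case
  proof (cases "I = {}")
    case True
    then show ?thesis by (simp add: moore_real_def)
  next
    case False
    define k where "k = Min I"
    have k: "k \<in> I" using fin False by (simp add: k_def)
    have "moore_sum A I =
        - (\<Sum>s\<in>paths (I - {k}). moore_sum A (I - {k} - set s) * walk A (k # s @ [k]))"
      unfolding k_def by (rule moore_sum_rec[OF fin False])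
    also have "(\<Sum>s\<in>paths (I - {k}). moore_sum A (I - {k} - set s) * walk A (k # s @ [k])) =
        (\<Sum>s\<in>paths (I - {k}). moore_real (I - {k} - set s) *\<^sub>R walk A (k # s @ [k]))"
    proof (rule sum.cong)
      fix s
      have "card (I - {k} - set s) < card I"
        using k fin by (intro psubset_card_mono) auto
      then have "moore_sum A (I - {k} - set s) = of_real (moore_real (I - {k} - set s))"
        using less by blast
      then show "moore_sum A (I - {k} - set s) * walk A (k # s @ [k]) =
          moore_real (I - {k} - set s) *\<^sub>R walk A (k # s @ [k])"
        by (simp add: scaleR_conv_of_real)
    qed simp
    also have "\<dots> = of_real (\<Sum>s\<in>paths (I - {k}). moore_real (I - {k} - set s) * qre (walk A (k # s @ [k])))"
      using less.prems k by (intro sum_closed_walks_real) auto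
    finally have "moore_sum A I = of_real (- (\<Sum>s\<in>paths (I - {k}).
        moore_real (I - {k} - set s) * qre (walk A (k # s @ [k]))))" by simp
    then show ?thesis unfolding moore_real_def by (simp add: of_real_def)
  qed
qed

section \<open>Expansion of Moore determinants along an arbitrary index\<close>

definition expansion :: "nat \<Rightarrow> nat set \<Rightarrow> real" where
  "expansion j I = - (\<Sum>s\<in>paths (I - {j}). moore_real (I - {j} - set s) * qre (walk A (j # s @ [j])))"

lemma moore_real_expansion_Min:
  assumes "I \<subseteq> U" "I \<noteq> {}"
  shows "moore_real I = expansion (Min I) I"
proof -
  have fin: "finite I" using assms finite_U finite_subset by blast
  have "moore_real I = - (\<Sum>s\<in>paths (I - {Min I}).
      qre (moore_sum A (I - {Min I} - set s) * walk A (Min I # s @ [Min I])))"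
    unfolding moore_real_def by (subst moore_sum_rec[OF fin assms(2)]) (simp add: qre_sum)
  also have "\<dots> = expansion (Min I) I"
    unfolding expansion_def
  proof (intro arg_cong[where f = uminus] sum.cong refl)
    fix s
    have "moore_sum A (I - {Min I} - set s) = of_real (moore_real (I - {Min I} - set s))"
      using assms by (intro moore_sum_eq_moore_real) auto
    then show "qre (moore_sum A (I - {Min I} - set s) * walk A (Min I # s @ [Min I])) =
        moore_real (I - {Min I} - set s) * qre (walk A (Min I # s @ [Min I]))"
      by (simp flip: scaleR_conv_of_real)
  qed
  finally show ?thesis .
qed

text \<open>The cycle through \<open>j\<close> either avoids \<open>k\<close>, and then the
  complement is expanded along \<open>k\<close>, or passes through \<open>k\<close> and is cut there
  into two paths. Both resulting sums have a form that is symmetric in \<open>j\<close> and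
  \<open>k\<close>. The assumption \<open>smaller\<close> stands for an induction
  hypothesis.\<close>

lemma expansion_split:
  assumes "I \<subseteq> U" "j \<in> I" "k \<in> I" "j \<noteq> k"
    and smaller: "\<And>J. J \<subset> I \<Longrightarrow> k \<in> J \<Longrightarrow> moore_real J = expansion k J"
  defines "S \<equiv> I - {j, k}"
  shows "expansion j I =
    (\<Sum>(s, t)\<in>path_pairs S. moore_real (S - set s - set t) *
      (qre (walk A (j # s @ [j])) * qre (walk A (k # t @ [k]))))
    - (\<Sum>(u, v)\<in>path_pairs S. moore_real (S - set u - set v) *
        qre (walk A (j # u @ [k]) * walk A (k # v @ [j])))"
proof -
  have fin: "finite I" using assms finite_U finite_subset by blast
  have S: "I - {j} - {k} = S" and finS: "finite S" using fin by (auto simp: S_def)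
  let ?f = "\<lambda>s. moore_real (I - {j} - set s) * qre (walk A (j # s @ [j]))"
  have "expansion j I = - (\<Sum>s\<in>paths S. ?f s) - (\<Sum>(u, v)\<in>path_pairs S. ?f (u @ k # v))"
    unfolding expansion_def using fin assms by (subst sum_paths_split[of _ k]) (simp_all add: S)
  also have "(\<Sum>(u, v)\<in>path_pairs S. ?f (u @ k # v)) =
      (\<Sum>(u, v)\<in>path_pairs S. moore_real (S - set u - set v) *
        qre (walk A (j # u @ [k]) * walk A (k # v @ [j])))"
  proof (rule sum.cong, simp, clarify)
    fix u v
    have "I - {j} - set (u @ k # v) = S - set u - set v" by (auto simp: S_def)
    then show "?f (u @ k # v) = moore_real (S - set u - set v) *
        qre (walk A (j # u @ [k]) * walk A (k # v @ [j]))"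
      using walk_append[of A "j # u" k "v @ [j]"] by simp
  qed
  also have "- (\<Sum>s\<in>paths S. ?f s) =
      (\<Sum>(s, t)\<in>path_pairs S. moore_real (S - set s - set t) *
        (qre (walk A (j # s @ [j])) * qre (walk A (k # t @ [k]))))"
  proof -
    have "- ?f s = (\<Sum>t\<in>paths (S - set s). moore_real (S - set s - set t) *
        (qre (walk A (j # s @ [j])) * qre (walk A (k # t @ [k]))))"
      if s: "s \<in> paths S" for s
    proof -
      have "k \<in> I - {j} - set s" using assms s by (auto simp: paths_def)
      then have "moore_real (I - {j} - set s) = expansion k (I - {j} - set s)"
        using assms by (intro smaller) auto
      moreover have "I - {j} - set s - {k} = S - set s" by (auto simp: S_def)
      ultimately show ?thesis
        by (simp add: expansion_def sum_distrib_left sum_distrib_right mult_ac)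
    qed
    then show ?thesis using finS by (simp add: sum_path_pairs flip: sum_negf)
  qed
  finally show ?thesis .
qed

text \<open>The symmetry of \<open>expansion_split\<close> shows that the expansion along
  \<open>j\<close> equals the one along \<open>Min I\<close>, which is known from the
  recursion.\<close>

lemma moore_real_expansion: "I \<subseteq> U \<Longrightarrow> j \<in> I \<Longrightarrow> moore_real I = expansion j I"
proof (induction "card I" arbitrary: I j rule: less_induct)
  case less
  then have fin: "finite I" using finite_U finite_subset by blast
  have smaller: "moore_real J = expansion i J" if "J \<subset> I" "i \<in> J" for J i
    using that less.prems less.hyps[of J i] fin psubset_card_mono[of I J] by blast
  define k where "k = Min I"
  have k: "k \<in> I" unfolding k_def using fin less.prems by (intro Min_in) auto
  have "expansion j I = expansion k I"
  proof (cases "j = k")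
    case False
    define S where "S = I - {j, k}"
    have S: "I - {k, j} = S" "I - {j, k} = S" "S - X - Y = S - Y - X" for X Y
      by (auto simp: S_def)
    have "expansion j I =
      (\<Sum>(s, t)\<in>path_pairs S. moore_real (S - set s - set t) *
        (qre (walk A (j # s @ [j])) * qre (walk A (k # t @ [k]))))
      - (\<Sum>(u, v)\<in>path_pairs S. moore_real (S - set u - set v) *
          qre (walk A (j # u @ [k]) * walk A (k # v @ [j])))"
      using expansion_split[OF less.prems k False] smaller unfolding S(2) by blast
    also have "\<dots> =
      (\<Sum>(s, t)\<in>path_pairs S. moore_real (S - set s - set t) *
        (qre (walk A (k # s @ [k])) * qre (walk A (j # t @ [j]))))
      - (\<Sum>(u, v)\<in>path_pairs S. moore_real (S - set u - set v) *
          qre (walk A (k # u @ [j]) * walk A (j # v @ [k])))"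
    \<comment> \<open>Exchanging the two paths of a pair exchanges \<open>j\<close> and
      \<open>k\<close>: the first sum contains products of real numbers, the second the real part of
      a product, which is invariant under exchanging the factors.\<close>
    proof (rule arg_cong2[where f = minus]; rule trans[OF sum_path_pairs_swap]; intro sum.cong refl; clarify)
      fix s t
      show "moore_real (S - set t - set s) *
          (qre (walk A (j # t @ [j])) * qre (walk A (k # s @ [k]))) =
        moore_real (S - set s - set t) *
          (qre (walk A (k # s @ [k])) * qre (walk A (j # t @ [j])))"
        by (metis S(3) mult.commute)
      show "moore_real (S - set t - set s) * qre (walk A (j # t @ [k]) * walk A (k # s @ [j])) =
        moore_real (S - set s - set t) * qre (walk A (k # s @ [j]) * walk A (j # t @ [k]))"
        by (metis S(3) qre_mult_commute)
    qed
    also have "\<dots> = expansion k I"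
      using expansion_split[OF less.prems(1) k less.prems(2)] smaller False unfolding S(1) by metis
    finally show ?thesis .
  qed simp
  then show ?case
    using moore_real_expansion_Min less.prems unfolding k_def by auto
qed

section \<open>Right adjugate and the entries of the inverse\<close>

lemma moore_real_closed_walks:
  assumes "I \<subseteq> U" "j \<in> I"
  shows "of_real (moore_real I) =
    - (\<Sum>s\<in>paths (I - {j}). moore_real (I - {j} - set s) *\<^sub>R walk A (j # s @ [j]))"
  using assms by (subst sum_closed_walks_real) (auto simp: moore_real_expansion expansion_def)

text \<open>The \<open>(q, p)\<close> entry of the right adjugate. The path is
  \<open>r @ [p]\<close>, and its head is required to be \<open>q\<close>; for \<open>q = p\<close>
  only \<open>r = []\<close> remains, giving the complementary minor
  \<open>moore_real (J - {p})\<close>.\<close>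

definition path_sum :: "nat set \<Rightarrow> nat \<Rightarrow> nat \<Rightarrow> quat" where
  "path_sum J q p = (\<Sum>r | r \<in> paths (J - {p}) \<and> hd (r @ [p]) = q.
     moore_real (J - {p} - set r) *\<^sub>R walk A (r @ [p]))"

text \<open>The factor \<open>A x q\<close> prolongs a path from \<open>q\<close> by a step from
  \<open>x\<close>, at the cost of a sign; summing over \<open>q\<close> then removes the
  restriction on the first vertex.\<close>

lemma sum_mult_path_sum:
  assumes "J \<subseteq> U" "p \<in> J"
  shows "(\<Sum>q\<in>J. A x q * path_sum J q p) =
    - (\<Sum>r\<in>paths (J - {p}). moore_real (J - {p} - set r) *\<^sub>R walk A (x # r @ [p]))"
proof -
  have fin: "finite J" using assms finite_U finite_subset by blast
  have "(\<Sum>q\<in>J. A x q * path_sum J q p) =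
      (\<Sum>q\<in>J. \<Sum>r | r \<in> paths (J - {p}) \<and> hd (r @ [p]) = q.
        - (moore_real (J - {p} - set r) *\<^sub>R walk A (x # r @ [p])))"
    unfolding path_sum_def sum_distrib_left
    by (intro sum.cong refl) (auto simp: walk_Cons)
  also have "\<dots> = (\<Sum>r\<in>paths (J - {p}). - (moore_real (J - {p} - set r) *\<^sub>R walk A (x # r @ [p])))"
  proof (rule sum.group)
    show "(\<lambda>r. hd (r @ [p])) ` paths (J - {p}) \<subseteq> J"
      using assms by (auto simp: paths_def hd_append dest: hd_in_set)
  qed (use fin in auto)
  finally show ?thesis by (simp add: sum_negf)
qed

text \<open>For \<open>x = p\<close> the walks close up and give the expansion along
  \<open>p\<close>. Otherwise a walk that returns to \<open>x\<close> is a loop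
  \<open>x # u @ [x]\<close> followed by a path \<open>x # v @ [p]\<close>. For fixed
  \<open>v\<close>, the loops sum to minus the Moore determinant of the complement, which cancels
  the walk along \<open>v\<close> without a loop.\<close>

lemma sum_mult_path_sum_inside:
  assumes "J \<subseteq> U" "p \<in> J" "x \<in> J"
  shows "(\<Sum>q\<in>J. A x q * path_sum J q p) = (if x = p then of_real (moore_real J) else 0)"
proof (cases "x = p")
  case True
  then show ?thesis
    using assms by (simp add: sum_mult_path_sum moore_real_closed_walks)
next
  case False
  have fin: "finite J" using assms finite_U finite_subset by blast
  define S where "S = J - {p} - {x}"
  have finS: "finite S" using fin by (simp add: S_def)
  let ?f = "\<lambda>r. moore_real (J - {p} - set r) *\<^sub>R walk A (x # r @ [p])"
  have "(\<Sum>r\<in>paths (J - {p}). ?f r) =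
      (\<Sum>r\<in>paths S. ?f r) + (\<Sum>(u, v)\<in>path_pairs S. ?f (u @ x # v))"
    using fin assms False by (subst sum_paths_split[of _ x]) (simp_all add: S_def)
  \<comment> \<open>The swap makes \<open>v\<close> the outer variable, so that the loops
    \<open>u\<close> can be summed first.\<close>
  also have "(\<Sum>(u, v)\<in>path_pairs S. ?f (u @ x # v)) =
      (\<Sum>(v, u)\<in>path_pairs S. ?f (u @ x # v))"
    by (rule sum_path_pairs_swap)
  also have "\<dots> = (\<Sum>v\<in>paths S. - ?f v)"
    unfolding sum_path_pairs[OF finS]
  proof (rule sum.cong)
    fix v assume v: "v \<in> paths S"
    define K where "K = J - {p} - set v"
    have K: "K \<subseteq> U" "x \<in> K" "S - set v = K - {x}"
      using assms False v by (auto simp: K_def S_def paths_def)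
    have "(\<Sum>u\<in>paths (S - set v). ?f (u @ x # v)) =
        (\<Sum>u\<in>paths (K - {x}). moore_real (K - {x} - set u) *\<^sub>R walk A (x # u @ [x])) * walk A (x # v @ [p])"
      unfolding K(3) sum_distrib_right
    proof (rule sum.cong)
      fix u
      have "J - {p} - set (u @ x # v) = K - {x} - set u" by (auto simp: K_def)
      then show "?f (u @ x # v) =
          moore_real (K - {x} - set u) *\<^sub>R walk A (x # u @ [x]) * walk A (x # v @ [p])"
        using walk_append[of A "x # u" x "v @ [p]"] by simp
    qed simp
    also have "\<dots> = - of_real (moore_real K) * walk A (x # v @ [p])"
      using K by (simp add: moore_real_closed_walks)
    finally show "(\<Sum>u\<in>paths (S - set v). ?f (u @ x # v)) = - ?f v"
      by (simp add: K_def scaleR_conv_of_real)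
  qed simp
  finally show ?thesis
    using assms False by (simp add: sum_mult_path_sum sum_negf)
qed

text \<open>Multiplying the right adjugate identity by \<open>B\<close> on the left gives this
  without dividing by \<open>moore_real J\<close>.\<close>

lemma inverse_mult_moore_real:
  assumes "J \<subseteq> U" "is_inverse_on A J J B" "q \<in> J" "p \<in> J"
  shows "B q p * of_real (moore_real J) = path_sum J q p"
proof -
  have fin: "finite J" using assms finite_U finite_subset by blast
  have "B q p * of_real (moore_real J) =
      (\<Sum>x\<in>J. if x = p then B q x * of_real (moore_real J) else 0)"
    using fin assms by simp
  also have "\<dots> = (\<Sum>x\<in>J. B q x * (\<Sum>q'\<in>J. A x q' * path_sum J q' p))"
    using assms by (intro sum.cong) (auto simp: sum_mult_path_sum_inside)
  also have "\<dots> = (\<Sum>q'\<in>J. (\<Sum>x\<in>J. B q x * A x q') * path_sum J q' p)"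
    unfolding sum_distrib_left sum_distrib_right mult.assoc by (rule sum.swap)
  also have "\<dots> = (\<Sum>q'\<in>J. if q = q' then path_sum J q' p else 0)"
    using assms by (intro sum.cong) (auto simp: is_inverse_on_def)
  also have "\<dots> = path_sum J q p"
    using fin assms by simp
  finally show ?thesis .
qed

section \<open>Quasideterminants as ratios of Moore determinants\<close>

lemma quasidet_mult_moore_real:
  assumes "I \<subseteq> U" "k \<in> I" "invertible_on A (I - {k}) (I - {k})"
  shows "quasidet A I I k k * of_real (moore_real (I - {k})) = of_real (moore_real I)"
proof -
  define J where "J = I - {k}"
  define B where "B = inverse_on A J J"
  have J: "J \<subseteq> U" and fin: "finite J"
    using assms finite_U finite_subset[of J U] by (auto simp: J_def)
  have B: "is_inverse_on A J J B"
    using assms(3) unfolding B_def inverse_on_def invertible_on_def J_def by (rule someI_ex)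
  let ?f = "\<lambda>s. moore_real (J - set s) *\<^sub>R walk A (k # s @ [k])"
  \<comment> \<open>The real factor is moved past \<open>A p k\<close> to reach the inverse entry,
    which it turns into a \<open>path_sum\<close>. Then \<open>A k q\<close> and
    \<open>A p k\<close> close the path from \<open>q\<close> to \<open>p\<close> into a cycle
    through \<open>k\<close>.\<close>
  have "(\<Sum>q\<in>J. \<Sum>p\<in>J. A k q * B q p * A p k) * of_real (moore_real J) =
      (\<Sum>p\<in>J. (\<Sum>q\<in>J. A k q * (B q p * of_real (moore_real J))) * A p k)"
    unfolding sum_distrib_right
    by (subst sum.swap, intro sum.cong refl) (metis mult.assoc mult_of_real_commute)
  also have "\<dots> = (\<Sum>p\<in>J. (\<Sum>q\<in>J. A k q * path_sum J q p) * A p k)"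
    using J B by (intro sum.cong arg_cong2[where f = "(*)"] refl) (auto simp: inverse_mult_moore_real)
  also have "\<dots> = (\<Sum>p\<in>J. \<Sum>r\<in>paths (J - {p}). ?f (r @ [p]))"
  proof (rule sum.cong)
    fix p assume p: "p \<in> J"
    have "J - set (r @ [p]) = J - {p} - set r" for r by auto
    moreover have "walk A (k # r @ [p, k]) = - (walk A (k # r @ [p]) * A p k)" for r
      using walk_append[of A "k # r" p "[k]"] by simp
    ultimately show "(\<Sum>q\<in>J. A k q * path_sum J q p) * A p k = (\<Sum>r\<in>paths (J - {p}). ?f (r @ [p]))"
      by (simp add: sum_mult_path_sum[OF J p] sum_distrib_right sum_negf)
  qed simp
  finally have sums: "(\<Sum>q\<in>J. \<Sum>p\<in>J. A k q * B q p * A p k) * of_real (moore_real J) =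
      (\<Sum>p\<in>J. \<Sum>r\<in>paths (J - {p}). ?f (r @ [p]))" .
  \<comment> \<open>The diagonal entry supplies the empty path, that is, the fixed point
    \<open>k\<close>, which the double sum lacks.\<close>
  have "A k k * of_real (moore_real J) = - ?f []"
    by (simp add: scaleR_conv_of_real mult_of_real_commute[of "A k k"])
  then have "quasidet A I I k k * of_real (moore_real J) =
      - (?f [] + (\<Sum>p\<in>J. \<Sum>r\<in>paths (J - {p}). ?f (r @ [p])))"
    unfolding quasidet_def J_def[symmetric] B_def[symmetric] left_diff_distrib sums
    by (simp only: minus_add_distrib diff_conv_add_uminus)
  also have "\<dots> = - (\<Sum>s\<in>paths J. ?f s)"
    unfolding sum_paths_last[OF fin, of ?f] ..
  also have "\<dots> = of_real (moore_real I)"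
    unfolding J_def by (rule moore_real_closed_walks[OF assms(1,2), symmetric])
  finally show ?thesis unfolding J_def .
qed

end

theorem theorem4p3:
  fixes A :: "nat \<Rightarrow> nat \<Rightarrow> quat" and n :: nat
  assumes "n \<ge> 1"
    and "\<forall>i\<in>{1..n}. \<forall>j\<in>{1..n}. A j i = qcnj (A i j)"
    and "\<forall>I J. I \<subseteq> {1..n} \<and> J \<subseteq> {1..n} \<and> card I = card J \<longrightarrow> invertible_on A I J"
  shows "predet n A = moore_det n A"
proof -
  interpret hermitian_matrix A "{1..n}"
    using assms(2) by unfold_locales blast+
  \<comment> \<open>The product telescopes from its right end: the induction descends from
    \<open>m = n + 1\<close>, where the product and the index set are empty, and each new factor
    stands to the left of a tail already known to be real.\<close>
  have "(\<Prod>k\<leftarrow>[m..<n+1]. quasidet A ({1..n} - {1..<k}) ({1..n} - {1..<k}) k k) =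
      of_real (moore_real {m..n})" if "m \<le> n + 1" "1 \<le> m" for m
    using that
  proof (induction rule: inc_induct)
    case base
    then show ?case by (simp add: moore_real_def)
  next
    case (step m)
    have eqs: "{1..n} - {1..<m} = {m..n}" "{m..n} - {m} = {Suc m..n}"
      using step by auto
    have "quasidet A {m..n} {m..n} m m * of_real (moore_real {Suc m..n}) =
        of_real (moore_real {m..n})"
      using quasidet_mult_moore_real[of "{m..n}" m] step assms(3) unfolding eqs by simp
    then show ?case
      using step by (simp add: upt_conv_Cons eqs del: upt_Suc)
  qed
  from this[of 1] have "predet n A = of_real (moore_real {1..n})"
    unfolding predet_def by simp
  then show ?thesis
    by (simp add: moore_det_eq_moore_sum moore_sum_eq_moore_real)
qed

end
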